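(* Let $N=2n\ge 2$ be even and let $M=(m_{ij})_{1\le i,j\le N}$ be an invertible skew-symmetric $N\times N$ complex matrix. Then the form $$\alpha_M:={}^tZ\,M\,dZ=\sum_{i,j=1}^N z_i\,m_{ij}\,dz_j$$ is a holomorphic twist form of charge $2$ on $\mathbb C^N\setminus\{0\}$ for the diagonal action of $S^1$. Conversely, any holomorphic twist form of charge $2$ on $\mathbb C^N\setminus\{0\}$ for the diagonal action of $S^1$ is of this form.
   Context: $Z={}^t(z_1,\dots,z_N)$ is the column vector of coordinates and $dZ={}^t(dz_1,\dots,dz_N)$. The diagonal action of $S^1$ on $\mathbb C^N\setminus\{0\}$ is $e^{it}\cdot z=e^{it}z$, with generating real vector field $V$ and holomorphic Euler vector field $\xi=\sum_j z_j\partial_{z_j}$. A twist form for this action is a $1$-form $\alpha$ that is (1) a nowhere-vanishing $(1,0)$-form; (2) horizontal: $\alpha(V)=0$ (equivalently $\alpha(\xi)=0$); (3) charge definite: $\mathcal L_V\alpha=ik\,\alpha$ for some constant $k$. One then says that $\alpha$ has charge $k$; for holomorphic $\alpha$ this is equivalent to $\mathcal L_\xi\alpha=k\alpha$. A holomorphic twist form is a twist form which is a holomorphic $1$-form. *)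

theory Defs
  imports "HOL-Analysis.Analysis"
begin

text \<open>
  A complex-valued differential 1-form on an open set \<open>U\<close> of complex \<open>N\<close>-space is a function
  \<open>\<alpha> z v\<close> of a point \<open>z\<close> and a tangent vector \<open>v\<close>, real-linear in \<open>v\<close>, of which only the values
  at points of \<open>U\<close> matter. The dimension \<open>N\<close> is the cardinality of the index type.
\<close>

type_synonym 'n oneform = "complex ^ 'n \<Rightarrow> complex ^ 'n \<Rightarrow> complex"

abbreviation punctured_space :: "(complex ^ 'n) set" where
  "punctured_space \<equiv> UNIV - {0}"

text \<open>Iterated directional derivatives; the intended domains \<open>U\<close> are open subsets of
  finite-dimensional spaces.\<close>

primrec C_on :: "nat \<Rightarrow> ('a::real_normed_vector) set \<Rightarrow> ('a \<Rightarrow> 'b::real_normed_vector) \<Rightarrow> bool" where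
  "C_on 0 U f \<longleftrightarrow> continuous_on U f"
| "C_on (Suc k) U f \<longleftrightarrow>
     (\<forall>x\<in>U. f differentiable (at x)) \<and> (\<forall>v. C_on k U (\<lambda>x. frechet_derivative f (at x) v))"

definition smooth_on :: "('a::real_normed_vector) set \<Rightarrow> ('a \<Rightarrow> 'b::real_normed_vector) \<Rightarrow> bool" where
  "smooth_on U f \<longleftrightarrow> (\<forall>k. C_on k U f)"

text \<open>Complex differentiability in several variables: the real Frechet derivative exists and is
  complex-linear.\<close>

definition holomorphic_several_on :: "(complex ^ 'n \<Rightarrow> complex) \<Rightarrow> (complex ^ 'n) set \<Rightarrow> bool" where
  "holomorphic_several_on f U \<longleftrightarrow>
     (\<forall>z\<in>U. \<exists>D. (f has_derivative D) (at z) \<and> Vector_Spaces.linear (*s) (*) D)"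

definition smooth_oneform_on :: "(complex ^ 'n) set \<Rightarrow> 'n oneform \<Rightarrow> bool" where
  "smooth_oneform_on U \<alpha> \<longleftrightarrow> (\<forall>z\<in>U. linear (\<alpha> z)) \<and> (\<forall>v. smooth_on U (\<lambda>z. \<alpha> z v))"

text \<open>Type (1,0), i.e. no conjugate-differential components: complex-linear on each tangent space.\<close>

definition type_1_0_on :: "(complex ^ 'n) set \<Rightarrow> 'n oneform \<Rightarrow> bool" where
  "type_1_0_on U \<alpha> \<longleftrightarrow> (\<forall>z\<in>U. Vector_Spaces.linear (*s) (*) (\<alpha> z))"

text \<open>The coefficient of \<open>dz\<^sub>j\<close> in a (1,0)-form is its value on the \<open>j\<close>-th coordinate vector.\<close>

definition holomorphic_oneform_on :: "(complex ^ 'n) set \<Rightarrow> 'n oneform \<Rightarrow> bool" where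
  "holomorphic_oneform_on U \<alpha> \<longleftrightarrow>
     type_1_0_on U \<alpha> \<and> (\<forall>j. holomorphic_several_on (\<lambda>z. \<alpha> z (axis j 1)) U)"

definition pullback :: "(complex ^ 'n \<Rightarrow> complex ^ 'n) \<Rightarrow> 'n oneform \<Rightarrow> 'n oneform" where
  "pullback F \<alpha> z v = \<alpha> (F z) (frechet_derivative F (at z) v)"

definition generating_field ::
    "(real \<Rightarrow> complex ^ 'n \<Rightarrow> complex ^ 'n) \<Rightarrow> complex ^ 'n \<Rightarrow> complex ^ 'n" where
  "generating_field \<Phi> z = vector_derivative (\<lambda>t. \<Phi> t z) (at 0)"

text \<open>\<open>\<Phi>\<close> is the flow of a vector field \<open>V\<close>; the Lie derivative of \<open>\<alpha>\<close> along \<open>V\<close> is the derivative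
  at time \<open>0\<close> of the pullbacks of \<open>\<alpha>\<close> by the flow. The predicate says that it exists and equals
  \<open>\<beta>\<close> on \<open>U\<close>.\<close>

definition has_Lie_derivative_on ::
    "(complex ^ 'n) set \<Rightarrow> (real \<Rightarrow> complex ^ 'n \<Rightarrow> complex ^ 'n) \<Rightarrow> 'n oneform \<Rightarrow> 'n oneform \<Rightarrow> bool" where
  "has_Lie_derivative_on U \<Phi> \<alpha> \<beta> \<longleftrightarrow>
     (\<forall>z\<in>U. \<forall>v. ((\<lambda>t. pullback (\<Phi> t) \<alpha> z v) has_vector_derivative \<beta> z v) (at 0))"

definition diagonal_action :: "real \<Rightarrow> complex ^ 'n \<Rightarrow> complex ^ 'n" where
  "diagonal_action t z = exp (\<i> * of_real t) *s z"

definition has_charge :: "complex \<Rightarrow> 'n::finite oneform \<Rightarrow> bool" where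
  "has_charge k \<alpha> \<longleftrightarrow>
     has_Lie_derivative_on punctured_space diagonal_action \<alpha> (\<lambda>z v. \<i> * k * \<alpha> z v)"

definition twist_form :: "'n::finite oneform \<Rightarrow> bool" where
  "twist_form \<alpha> \<longleftrightarrow>
     smooth_oneform_on punctured_space \<alpha> \<and>
     type_1_0_on punctured_space \<alpha> \<and>
     (\<forall>z\<in>punctured_space. \<exists>v. \<alpha> z v \<noteq> 0) \<and>
     (\<forall>z\<in>punctured_space. \<alpha> z (generating_field diagonal_action z) = 0) \<and>
     (\<exists>k. has_charge k \<alpha>)"

definition holomorphic_twist_form :: "'n::finite oneform \<Rightarrow> bool" where
  "holomorphic_twist_form \<alpha> \<longleftrightarrow> twist_form \<alpha> \<and> holomorphic_oneform_on punctured_space \<alpha>"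

definition skew_symmetric :: "complex ^ 'n ^ 'n \<Rightarrow> bool" where
  "skew_symmetric M \<longleftrightarrow> transpose M = - M"

text \<open>The form \<open>\<Sum>\<^sub>i\<^sub>j z\<^sub>i m\<^sub>i\<^sub>j dz\<^sub>j\<close>; as a covector \<open>dz\<^sub>j\<close> is \<open>v \<mapsto> v $ j\<close>.\<close>

definition matrix_form :: "complex ^ 'n ^ 'n \<Rightarrow> 'n::finite oneform" where
  "matrix_form M z v = (\<Sum>i\<in>UNIV. \<Sum>j\<in>UNIV. z $ i * M $ i $ j * v $ j)"

lemma diagonal_action_has_vector_derivative:
  "((\<lambda>t. diagonal_action t z) has_vector_derivative \<i> *s diagonal_action t z) (at t)"
proof -
  have "((\<lambda>t. exp (\<i> * complex_of_real t)) has_vector_derivative (\<i> * exp (\<i> * of_real t))) (at t)"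
    by (auto intro!: derivative_eq_intros has_vector_derivative_real_field)
  moreover have "bounded_linear (\<lambda>c::complex. c *s z)"
    unfolding linear_conv_bounded_linear[symmetric]
    by (intro linearI) (auto simp: vec_eq_iff algebra_simps)
  ultimately show ?thesis
    using bounded_linear.has_vector_derivative
    by (fastforce simp: diagonal_action_def vector_smult_assoc)
qed

text \<open>So \<open>diagonal_action\<close> is the flow of its generating field \<open>V\<close>.\<close>

lemma generating_field_diagonal_action: "generating_field diagonal_action z = \<i> *s z"
  using vector_derivative_at[OF diagonal_action_has_vector_derivative[of z 0]]
  by (simp add: generating_field_def diagonal_action_def)

end

theory Submission
  imports Defs "HOL-Complex_Analysis.Cauchy_Integral_Formula"
begin

text \<open>
  Write \<open>\<alpha>\<^sub>M\<close> for the form given by the matrix \<open>M\<close>. Its value \<open>\<alpha>\<^sub>M z v\<close> is a bilinear form in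
  \<open>(z, v)\<close>, so the conditions on a twist form become linear algebra. Since \<open>V = \<i> z\<close>, being
  horizontal means that the bilinear form is alternating, i.e. that \<open>M\<close> is skew-symmetric
  (\<open>skew_symmetric_iff_alternating\<close>); vanishing nowhere means that it is nondegenerate, i.e. that
  \<open>M\<close> is invertible (\<open>invertible_iff_matrix_form_nondegenerate\<close>). The charge is 2 because the
  rotation \<open>e\<^sup>i\<^sup>t\<close> acts on both arguments. This settles one direction, and it reduces
  the converse to showing that a holomorphic form of charge 2 has coefficients that are linear
  functions of \<open>z\<close>.

  The differential \<open>dz\<^sub>j\<close> has charge 1, so each coefficient \<open>f\<close> has charge 1 as well.
  Infinitesimally this is the Euler relation \<open>Df(z) z = f(z)\<close> (\<open>Euler_relation_if_charge_2\<close>), where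
  complex-linearity of the derivative allows the factor \<open>\<i>\<close> of the rotation field to be cancelled.
  Integrating it along punctured complex lines gives \<open>f(c z) = c f(z)\<close> for \<open>c \<noteq> 0\<close>.

  Such an \<open>f\<close> equals its own derivative at any point \<open>w \<noteq> 0\<close>, hence is linear
  (\<open>homogeneous_eq_derivative\<close>). On the line spanned by \<open>w\<close> this is the Euler relation with homogeneity. For \<open>z\<close> off
  that line, the line \<open>z + s w\<close> misses the origin, so \<open>h(s) = f(z + s w) - s f(w)\<close> is entire. With
  \<open>c = 1/s\<close>, homogeneity turns \<open>h(s)\<close> into the difference quotient \<open>(f(w + c z) - f(w)) / c\<close>, which
  tends to \<open>Df(w) z\<close> as \<open>s\<close> tends to infinity. By Liouville \<open>h\<close> is constant, and
  \<open>f(z) = h(0) = Df(w) z\<close>.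
\<close>

section \<open>Skew-symmetric bilinear forms\<close>

lemma matrix_form_eq_sum_vector_matrix:
  "matrix_form M z v = (\<Sum>j\<in>UNIV. (z v* M) $ j * v $ j)"
  unfolding matrix_form_def vector_matrix_mult_def
  by (subst sum.swap) (simp add: sum_distrib_left sum_distrib_right mult_ac)

lemma matrix_form_axis_right: "matrix_form M z (axis j 1) = (z v* M) $ j"
  by (simp add: matrix_form_eq_sum_vector_matrix axis_def if_distrib cong: if_cong)

lemma matrix_form_axis_axis: "matrix_form M (axis i 1) (axis j 1) = M $ i $ j"
  unfolding matrix_form_axis_right
  by (simp add: vector_matrix_mult_def axis_def mult_delta_left)

lemma matrix_form_add_left: "matrix_form M (y + z) v = matrix_form M y v + matrix_form M z v"
  by (simp add: matrix_form_def algebra_simps sum.distrib)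

lemma matrix_form_add_right: "matrix_form M z (v + w) = matrix_form M z v + matrix_form M z w"
  by (simp add: matrix_form_def algebra_simps sum.distrib)

lemma matrix_form_scale_left: "matrix_form M (c *s z) v = c * matrix_form M z v"
  by (simp add: matrix_form_def algebra_simps sum_distrib_left)

lemma matrix_form_scale_right: "matrix_form M z (c *s v) = c * matrix_form M z v"
  by (simp add: matrix_form_def algebra_simps sum_distrib_left)

lemma complex_linear_matrix_form_right: "Vector_Spaces.linear (*s) (*) (matrix_form M z)"
  by unfold_locales
    (auto simp: matrix_form_add_right matrix_form_scale_right algebra_simps)

lemma complex_linear_matrix_form_left:
  "Vector_Spaces.linear (*s) (*) (\<lambda>z. matrix_form M z v)"
  by unfold_locales
    (auto simp: matrix_form_add_left matrix_form_scale_left algebra_simps)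

text \<open>The converse is polarisation on pairs of coordinate vectors.\<close>

lemma skew_symmetric_iff_alternating:
  "skew_symmetric M \<longleftrightarrow> (\<forall>z. matrix_form M z z = 0)"
proof
  assume "skew_symmetric M"
  have skew: "M $ i $ j = - M $ j $ i" for i j
  proof -
    have "transpose M $ j $ i = (- M) $ j $ i"
      using \<open>skew_symmetric M\<close> by (simp add: skew_symmetric_def)
    then show ?thesis
      by (simp add: transpose_def)
  qed
  show "\<forall>z. matrix_form M z z = 0"
  proof
    fix z
    have flip: "z $ j * M $ j $ i * z $ i = - (z $ i * M $ i $ j * z $ j)" for i j
      by (simp add: skew[of j i])
    have "matrix_form M z z = (\<Sum>i\<in>UNIV. \<Sum>j\<in>UNIV. z $ j * M $ j $ i * z $ i)"
      unfolding matrix_form_def by (rule sum.swap)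
    also have "\<dots> = (\<Sum>i\<in>UNIV. \<Sum>j\<in>UNIV. - (z $ i * M $ i $ j * z $ j))"
      by (intro sum.cong refl flip)
    also have "\<dots> = - matrix_form M z z"
      by (simp add: matrix_form_def sum_negf)
    finally have "matrix_form M z z + matrix_form M z z = 0"
      unfolding eq_neg_iff_add_eq_0 .
    then show "matrix_form M z z = 0"
      by simp
  qed
next
  assume *: "\<forall>z. matrix_form M z z = 0"
  have skew: "M $ j $ i = - M $ i $ j" for i j
  proof -
    have "matrix_form M (axis i 1 + axis j 1) (axis i 1 + axis j 1) = 0"
      using * by blast
    moreover have "matrix_form M (axis i 1) (axis i 1) = 0" "matrix_form M (axis j 1) (axis j 1) = 0"
      using * by blast+
    ultimately show ?thesis
      unfolding matrix_form_add_left matrix_form_add_right matrix_form_axis_axis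
      by (simp add: eq_neg_iff_add_eq_0 add.commute)
  qed
  show "skew_symmetric M"
    unfolding skew_symmetric_def transpose_def vec_eq_iff vec_lambda_beta vector_uminus_component
    by (intro allI skew)
qed

text \<open>
  The covector \<open>matrix_form M z\<close> has coordinates \<open>z v* M\<close>, so the points where the form vanishes
  are the kernel of the transpose of \<open>M\<close>.
\<close>

lemma invertible_iff_matrix_form_nondegenerate:
  "invertible M \<longleftrightarrow> (\<forall>z. z \<noteq> 0 \<longrightarrow> (\<exists>v. matrix_form M z v \<noteq> 0))"
proof -
  have "(\<exists>v. matrix_form M z v \<noteq> 0) \<longleftrightarrow> z v* M \<noteq> 0" for z
  proof
    assume "z v* M \<noteq> 0"
    then show "\<exists>v. matrix_form M z v \<noteq> 0"
      by (metis matrix_form_axis_right vec_eq_iff zero_index)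
  qed (auto simp: matrix_form_eq_sum_vector_matrix)
  moreover have "invertible M \<longleftrightarrow> (\<forall>z. transpose M *v z = 0 \<longrightarrow> z = 0)"
    unfolding invertible_right_inverse left_invertible_transpose[symmetric]
      matrix_left_invertible_ker ..
  ultimately show ?thesis
    by auto
qed

section \<open>Bilinear forms as smooth and holomorphic one-forms\<close>

lemma complex_linear_scale:
  assumes "Vector_Spaces.linear (*s) (*) (D :: complex ^ 'n \<Rightarrow> complex)"
  shows "D (c *s v) = c * D v"
proof -
  interpret D: Vector_Spaces.linear "(*s)" "(*)" D by fact
  show ?thesis by (rule D.scale)
qed

text \<open>
  Real linearity refers to the scaling \<open>*\<^sub>R\<close> of the real vector space structure, which has to
  be matched with the componentwise complex scaling \<open>*s\<close>.
\<close>

lemma real_linear_if_complex_linear: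
  assumes "Vector_Spaces.linear (*s) (*) (D :: complex ^ 'n \<Rightarrow> complex)"
  shows "linear D"
proof -
  interpret D: Vector_Spaces.linear "(*s)" "(*)" D by fact
  have "r *\<^sub>R v = complex_of_real r *s v" for r :: real and v :: "complex ^ 'n"
    by (simp add: vec_eq_iff scaleR_conv_of_real[where 'a = complex])
  then show ?thesis
    by (intro linearI) (simp_all add: D.add D.scale scaleR_conv_of_real)
qed

lemma C_on_const: "C_on k U (\<lambda>x. c)"
  by (induction k arbitrary: c) auto

text \<open>
  The first derivative in a fixed direction is constant, so all higher ones vanish.
\<close>

lemma smooth_on_bounded_linear:
  assumes "bounded_linear f"
  shows "smooth_on U f"
proof -
  have "frechet_derivative f (at x) = f" for x
    using assms by (metis bounded_linear_imp_has_derivative frechet_derivative_at)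
  then have "C_on k U f" for k
    using assms
    by (cases k) (auto simp: C_on_const linear_continuous_on bounded_linear_imp_differentiable)
  then show ?thesis
    by (simp add: smooth_on_def)
qed

lemma bounded_linear_if_complex_linear:
  assumes "Vector_Spaces.linear (*s) (*) (D :: complex ^ 'n::finite \<Rightarrow> complex)"
  shows "bounded_linear D"
  using real_linear_if_complex_linear[OF assms] linear_conv_bounded_linear by blast

lemma smooth_oneform_matrix_form: "smooth_oneform_on U (matrix_form M)"
  unfolding smooth_oneform_on_def
  by (simp add: real_linear_if_complex_linear complex_linear_matrix_form_right
      smooth_on_bounded_linear bounded_linear_if_complex_linear complex_linear_matrix_form_left)

lemma holomorphic_oneform_matrix_form: "holomorphic_oneform_on U (matrix_form M)"
  unfolding holomorphic_oneform_on_def type_1_0_on_def holomorphic_several_on_def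
  using complex_linear_matrix_form_right complex_linear_matrix_form_left
    bounded_linear_if_complex_linear bounded_linear_imp_has_derivative by blast

section \<open>Charge and the Euler relation\<close>

lemma frechet_derivative_diagonal_action:
  "frechet_derivative (diagonal_action t) (at z) = (diagonal_action t :: complex ^ 'n::finite \<Rightarrow> _)"
proof -
  have "linear (diagonal_action t :: complex ^ 'n \<Rightarrow> _)"
    by (intro linearI) (auto simp: diagonal_action_def vec_eq_iff algebra_simps)
  then show ?thesis
    by (metis bounded_linear_imp_has_derivative frechet_derivative_at linear_conv_bounded_linear)
qed

lemma pullback_diagonal_action:
  "pullback (diagonal_action t) \<alpha> z v = \<alpha> (diagonal_action t z) (diagonal_action t v)"
  by (simp add: pullback_def frechet_derivative_diagonal_action)

lemma has_vector_derivative_exp_i: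
  "((\<lambda>t. exp (c * complex_of_real t)) has_vector_derivative c) (at 0)"
  by (auto intro!: derivative_eq_intros has_vector_derivative_real_field)

lemma has_charge_2_matrix_form: "has_charge 2 (matrix_form M)"
proof -
  have "pullback (diagonal_action t) (matrix_form M) z v
      = exp (2 * \<i> * of_real t) * matrix_form M z v" for t z v
  proof -
    have "exp (2 * \<i> * of_real t) = exp (\<i> * of_real t) * exp (\<i> * of_real t)"
      by (simp add: mult.assoc flip: exp_add)
    then show ?thesis
      by (simp add: pullback_diagonal_action diagonal_action_def matrix_form_scale_left
          matrix_form_scale_right)
  qed
  moreover have "((\<lambda>t. exp (2 * \<i> * of_real t) * matrix_form M z v)
      has_vector_derivative 2 * \<i> * matrix_form M z v) (at 0)" for z v
    by (intro has_vector_derivative_mult_left has_vector_derivative_exp_i)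
  ultimately show ?thesis
    by (simp add: has_charge_def has_Lie_derivative_on_def mult_ac)
qed

text \<open>
  The pullback of \<open>\<alpha>\<close> under the rotation by \<open>t\<close>, evaluated at \<open>(z, v)\<close>, is a product of
  \<open>e\<^sup>i\<^sup>t\<close>, coming from \<open>v\<close>, and of the coefficient at the rotated point. Its derivative
  at 0 is \<open>\<i> \<alpha>(z)(v) + D(\<i> z)\<close> by the product rule, and \<open>2 \<i> \<alpha>(z)(v)\<close> by the charge.
\<close>

lemma Euler_relation_if_charge_2:
  fixes \<alpha> :: "'n::finite oneform"
  assumes type: "type_1_0_on punctured_space \<alpha>" and "has_charge 2 \<alpha>" and "z \<noteq> 0"
    and deriv: "((\<lambda>z. \<alpha> z v) has_derivative D) (at z)"
    and lin: "Vector_Spaces.linear (*s) (*) D"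
  shows "D z = \<alpha> z v"
proof -
  interpret D: Vector_Spaces.linear "(*s)" "(*)" D by fact
  have scaled: "\<alpha> (diagonal_action t z) (diagonal_action t v)
      = exp (\<i> * of_real t) * \<alpha> (diagonal_action t z) v" for t
  proof -
    have "Vector_Spaces.linear (*s) (*) (\<alpha> (diagonal_action t z))"
      using type \<open>z \<noteq> 0\<close> by (simp add: type_1_0_on_def diagonal_action_def)
    then show ?thesis
      by (simp add: diagonal_action_def complex_linear_scale)
  qed
  have "((\<lambda>t. \<alpha> (diagonal_action t z) (diagonal_action t v))
      has_vector_derivative \<i> * 2 * \<alpha> z v) (at 0)"
    using \<open>has_charge 2 \<alpha>\<close> \<open>z \<noteq> 0\<close>
    by (simp add: has_charge_def has_Lie_derivative_on_def pullback_diagonal_action)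
  then have "((\<lambda>t. exp (\<i> * of_real t) * \<alpha> (diagonal_action t z) v)
      has_vector_derivative \<i> * 2 * \<alpha> z v) (at 0)"
    unfolding scaled .
  moreover have "((\<lambda>t. exp (\<i> * of_real t) * \<alpha> (diagonal_action t z) v)
      has_vector_derivative \<i> * \<alpha> z v + \<i> * D z) (at 0)"
  proof -
    have flow: "((\<lambda>t. diagonal_action t z) has_vector_derivative \<i> *s z) (at 0)"
      using diagonal_action_has_vector_derivative[of z 0] by (simp add: diagonal_action_def)
    have "((\<lambda>t. \<alpha> (diagonal_action t z) v) has_vector_derivative D (\<i> *s z)) (at 0)"
      using has_derivative_compose[OF flow[unfolded has_vector_derivative_def], of "\<lambda>z. \<alpha> z v" D]
        deriv real_linear_if_complex_linear[OF lin]
      by (simp add: has_vector_derivative_def diagonal_action_def linear_scale)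
    from has_vector_derivative_mult[OF has_vector_derivative_exp_i[of \<i>] this] show ?thesis
      by (simp add: diagonal_action_def D.scale add.commute)
  qed
  ultimately have "\<i> * 2 * \<alpha> z v = \<i> * \<alpha> z v + \<i> * D z"
    by (rule vector_derivative_unique_at)
  then have "\<i> * (D z - \<alpha> z v) = 0"
    by (simp add: algebra_simps)
  then show ?thesis
    by simp
qed

section \<open>Homogeneous holomorphic functions on punctured space\<close>

lemma has_field_derivative_along_line:
  fixes f :: "complex ^ 'n::finite \<Rightarrow> complex"
  assumes "(f has_derivative D) (at (w + c *s z))" "Vector_Spaces.linear (*s) (*) D"
  shows "((\<lambda>c. f (w + c *s z)) has_field_derivative D z) (at c)"
proof -
  interpret D: Vector_Spaces.linear "(*s)" "(*)" D by fact
  have "bounded_linear (\<lambda>c::complex. c *s z)"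
    unfolding linear_conv_bounded_linear[symmetric]
    by (intro linearI) (auto simp: vec_eq_iff algebra_simps)
  then have "((\<lambda>c. w + c *s z) has_derivative (\<lambda>h. h *s z)) (at c)"
    by (auto intro!: derivative_eq_intros bounded_linear_imp_has_derivative)
  from has_derivative_compose[OF this assms(1)] show ?thesis
    by (simp add: has_field_derivative_def D.scale mult.commute[of _ "D z"])
qed

text \<open>
  By the Euler relation, \<open>f(c z) / c\<close> has derivative 0 in \<open>c\<close>. The substitution
  \<open>c = e\<^sup>u\<close> makes the domain the whole plane, so that constancy follows from convexity.
\<close>

lemma homogeneous_if_Euler_relation:
  fixes f :: "complex ^ 'n::finite \<Rightarrow> complex"
  assumes deriv: "\<And>z. z \<noteq> 0 \<Longrightarrow> (f has_derivative D z) (at z)"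
    and lin: "\<And>z. z \<noteq> 0 \<Longrightarrow> Vector_Spaces.linear (*s) (*) (D z)"
    and Euler: "\<And>z. z \<noteq> 0 \<Longrightarrow> D z z = f z"
    and "z \<noteq> 0" "c \<noteq> 0"
  shows "f (c *s z) = c * f z"
proof -
  have "((\<lambda>u. f (exp u *s z) / exp u) has_field_derivative 0) (at u)" for u
  proof -
    have nz: "exp u *s z \<noteq> 0"
      using \<open>z \<noteq> 0\<close> by simp
    have "((\<lambda>c. f (c *s z)) has_field_derivative D (exp u *s z) z) (at (exp u))"
      using has_field_derivative_along_line[of f _ 0 "exp u" z] deriv[OF nz] lin[OF nz] by simp
    then have "((\<lambda>u. f (exp u *s z)) has_field_derivative D (exp u *s z) z * exp u) (at u)"
      by (rule DERIV_chain2) (rule DERIV_exp)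
    moreover have "D (exp u *s z) z * exp u = f (exp u *s z)"
      using complex_linear_scale[OF lin[OF nz], of "exp u" z] Euler[OF nz] by simp
    ultimately have "((\<lambda>u. f (exp u *s z)) has_field_derivative f (exp u *s z)) (at u)"
      by simp
    then show ?thesis
      by (auto intro!: derivative_eq_intros)
  qed
  then obtain k where "f (exp u *s z) / exp u = k" for u
    using has_field_derivative_zero_constant[of UNIV "\<lambda>u. f (exp u *s z) / exp u"] by auto
  from this[of "Ln c"] this[of 0] show ?thesis
    using \<open>c \<noteq> 0\<close> by (simp add: field_simps)
qed

text \<open>
  Homogeneity of degree 1 relates the behaviour of \<open>f\<close> at infinity in the direction of \<open>w\<close> to
  its behaviour near \<open>w\<close> itself, and Liouville propagates this to every \<open>z\<close>. For fixed \<open>w\<close> the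
  right-hand side is linear in \<open>z\<close>, which is the point of the lemma.
\<close>

lemma homogeneous_eq_derivative:
  fixes f :: "complex ^ 'n::finite \<Rightarrow> complex"
  assumes deriv: "\<And>z. z \<noteq> 0 \<Longrightarrow> (f has_derivative D z) (at z)"
    and lin: "\<And>z. z \<noteq> 0 \<Longrightarrow> Vector_Spaces.linear (*s) (*) (D z)"
    and Euler: "\<And>z. z \<noteq> 0 \<Longrightarrow> D z z = f z"
    and "w \<noteq> 0" "z \<noteq> 0"
  shows "f z = D w z"
proof (cases "\<exists>c. z = c *s w")
  case True
  then obtain c where "z = c *s w" by blast
  then show ?thesis
    using homogeneous_if_Euler_relation[OF deriv lin Euler] assms
    by (auto simp: complex_linear_scale[OF lin])
next
  case False
  \<comment> \<open>This makes the function \<open>h\<close> below entire.\<close>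
  have nz: "z + s *s w \<noteq> 0" for s
    using False by (metis add_eq_0_iff2 vector_sneg_minus1 vector_smult_assoc)
  define h where "h s = f (z + s *s w) - s * f w" for s
  have "h holomorphic_on UNIV"
    unfolding h_def
    using has_field_derivative_along_line[OF deriv[OF nz] lin[OF nz]]
    by (intro holomorphic_intros)
      (meson UNIV_I field_differentiable_at_within field_differentiable_def holomorphic_onI)
  moreover have "(h \<longlongrightarrow> D w z) at_infinity"
  proof -
    have "((\<lambda>c. f (w + c *s z)) has_field_derivative D w z) (at 0)"
      using has_field_derivative_along_line[of f "D w" w 0 z] deriv lin \<open>w \<noteq> 0\<close> by simp
    then have "((\<lambda>c. (f (w + c *s z) - f w) / c) \<longlongrightarrow> D w z) (at 0)"
      by (simp add: has_field_derivative_iff)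
    moreover have "(f (w + c *s z) - f w) / c = h (inverse c)" if "c \<noteq> 0" for c
    proof -
      have eq: "w + c *s z = c *s (z + inverse c *s w)"
        using that by (simp add: vec_eq_iff algebra_simps)
      have "f (w + c *s z) = c * f (z + inverse c *s w)"
        unfolding eq using homogeneous_if_Euler_relation[OF deriv lin Euler] that nz by blast
      then show ?thesis
        using that by (simp add: h_def field_simps)
    qed
    ultimately have "((h \<circ> inverse) \<longlongrightarrow> D w z) (at 0)"
      by (auto simp: eventually_at_filter intro: Lim_transform_eventually)
    then show ?thesis
      by (simp add: lim_at_infinity_0)
  qed
  ultimately have "h 0 = D w z"
    by (rule Liouville_weak)
  then show ?thesis
    by (simp add: h_def)
qed

section \<open>The classification\<close>

lemma oneform_eq_sum_coefficients:
  assumes "Vector_Spaces.linear (*s) (*) (\<alpha> :: complex ^ 'n::finite \<Rightarrow> complex)"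
  shows "\<alpha> v = (\<Sum>j\<in>UNIV. \<alpha> (axis j 1) * v $ j)"
proof -
  interpret Vector_Spaces.linear "(*s)" "(*)" \<alpha> by fact
  have "\<alpha> v = \<alpha> (\<Sum>j\<in>UNIV. v $ j *s axis j 1)"
    by (simp add: basis_expansion)
  then show ?thesis
    by (simp add: sum scale mult.commute)
qed

text \<open>
  The coefficient of \<open>dz\<^sub>j\<close> agrees with its derivative at an auxiliary point \<open>w\<close>; the matrix collects
  the partial derivatives there.
\<close>

lemma holomorphic_charge_2_eq_matrix_form:
  fixes \<alpha> :: "'n::finite oneform"
  assumes "holomorphic_oneform_on punctured_space \<alpha>" and "has_charge 2 \<alpha>"
  obtains M where "\<And>z v. z \<noteq> 0 \<Longrightarrow> \<alpha> z v = matrix_form M z v"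
proof -
  have type: "type_1_0_on punctured_space \<alpha>"
    using assms by (simp add: holomorphic_oneform_on_def)
  have "\<exists>D. ((\<lambda>z. \<alpha> z (axis j 1)) has_derivative D) (at z) \<and> Vector_Spaces.linear (*s) (*) D"
    if "z \<noteq> 0" for z j
    using assms that by (simp add: holomorphic_oneform_on_def holomorphic_several_on_def)
  then obtain D where deriv: "\<And>z j. z \<noteq> 0 \<Longrightarrow> ((\<lambda>z. \<alpha> z (axis j 1)) has_derivative D z j) (at z)"
    and lin: "\<And>z j. z \<noteq> 0 \<Longrightarrow> Vector_Spaces.linear (*s) (*) (D z j)"
    by metis
  obtain w :: "complex ^ 'n" where "w \<noteq> 0"
    using zero_neq_one by blast
  define M :: "complex ^ 'n ^ 'n" where "M = (\<chi> i j. D w j (axis i 1))"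
  have "\<alpha> z v = matrix_form M z v" if "z \<noteq> 0" for z v
  proof -
    have "\<alpha> z (axis j 1) = D w j z" for j
      using Euler_relation_if_charge_2[OF type assms(2) _ deriv lin] \<open>w \<noteq> 0\<close> that
      by (intro homogeneous_eq_derivative[where D = "\<lambda>z. D z j"] deriv lin) auto
    also have "D w j z = (z v* M) $ j" for j
      using oneform_eq_sum_coefficients[OF lin[OF \<open>w \<noteq> 0\<close>], of j z]
      by (simp add: M_def vector_matrix_mult_def mult.commute)
    finally show ?thesis
      using oneform_eq_sum_coefficients[of "\<alpha> z" v] type that
      by (simp add: type_1_0_on_def matrix_form_eq_sum_vector_matrix)
  qed
  then show ?thesis
    by (rule that)
qed

theorem proposition4:
  assumes "even CARD('n::finite)"
  shows "(\<forall>M :: complex ^ 'n ^ 'n. skew_symmetric M \<and> invertible M \<longrightarrow>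
            holomorphic_twist_form (matrix_form M) \<and> has_charge 2 (matrix_form M)) \<and>
         (\<forall>\<alpha> :: 'n oneform. holomorphic_twist_form \<alpha> \<and> has_charge 2 \<alpha> \<longrightarrow>
            (\<exists>M :: complex ^ 'n ^ 'n. skew_symmetric M \<and> invertible M \<and>
               (\<forall>z\<in>punctured_space. \<forall>v. \<alpha> z v = matrix_form M z v)))"
proof (intro conjI allI impI; elim conjE)
  fix M :: "complex ^ 'n ^ 'n"
  assume "skew_symmetric M" "invertible M"
  then have "matrix_form M z (generating_field diagonal_action z) = 0"
    and "z \<noteq> 0 \<Longrightarrow> \<exists>v. matrix_form M z v \<noteq> 0" for z
    by (auto simp: generating_field_diagonal_action matrix_form_scale_right
        skew_symmetric_iff_alternating invertible_iff_matrix_form_nondegenerate)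
  then show "holomorphic_twist_form (matrix_form M)"
    unfolding holomorphic_twist_form_def twist_form_def
    using smooth_oneform_matrix_form holomorphic_oneform_matrix_form has_charge_2_matrix_form
    by (fastforce simp: holomorphic_oneform_on_def)
  show "has_charge 2 (matrix_form M)"
    by (rule has_charge_2_matrix_form)
next
  fix \<alpha> :: "'n oneform"
  assume twist: "holomorphic_twist_form \<alpha>" and charge: "has_charge 2 \<alpha>"
  then obtain M where M: "\<And>z v. z \<noteq> 0 \<Longrightarrow> \<alpha> z v = matrix_form M z v"
    using holomorphic_charge_2_eq_matrix_form unfolding holomorphic_twist_form_def by blast
  have "matrix_form M z z = 0" for z
  proof (cases "z = 0")
    case False
    then have "\<alpha> z (\<i> *s z) = 0"
      using twist
      by (simp add: holomorphic_twist_form_def twist_form_def generating_field_diagonal_action)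
    then show ?thesis
      using False by (simp add: M matrix_form_scale_right)
  qed (simp add: matrix_form_def)
  moreover have "\<exists>v. matrix_form M z v \<noteq> 0" if "z \<noteq> 0" for z
  proof -
    have "\<exists>v. \<alpha> z v \<noteq> 0"
      using twist that by (simp add: holomorphic_twist_form_def twist_form_def)
    then show ?thesis
      by (simp add: M[OF that])
  qed
  ultimately have "skew_symmetric M" "invertible M"
    by (simp_all add: skew_symmetric_iff_alternating invertible_iff_matrix_form_nondegenerate)
  then show "\<exists>M. skew_symmetric M \<and> invertible M \<and>
      (\<forall>z\<in>punctured_space. \<forall>v. \<alpha> z v = matrix_form M z v)"
    using M by blast
qed

end
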